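(* Consider an $N$-player quadratic game with costs $f_1,\ldots,f_N$, step sizes $\gamma_1,\ldots,\gamma_N>0$, and the associated matrix $W\in\mathbb{R}^{n\times n}$ and disturbed gradient-based learning dynamics described in the context, in which player $i$'s gradient is corrupted by an arbitrary disturbance. For $\ell\in[N]$ let $\mathcal{S}(\ell)=\{x=(x_1,\ldots,x_N)\in\mathbb{R}^n : x_m=0 \text{ for all } m\neq \ell\}$, and for a subspace $\mathcal{M}\subseteq\mathbb{R}^n$ let $\mathcal{M}^\perp=\{x\in\mathbb{R}^n : x^\top\tilde x=0\ \forall \tilde x\in\mathcal{M}\}$. For a player $j\neq i$, the following statements are equivalent: (i) Player $j$ is disturbance decoupled from player $i$. (ii) $W^k v\in\mathcal{S}(j)^\perp$ for all $v\in\mathcal{S}(i)$ and all integers $0\le k<n$. (iii) $\mathrm{im}(W^kE)\subseteq\mathrm{im}(Y)$ for all integers $0\le k<n$, where $E\in\mathbb{R}^{n\times n_i}$ and $Y\in\mathbb{R}^{n\times(n-n_j)}$ are any matrices with $\mathrm{im}(E)=\mathcal{S}(i)$ and $\mathrm{im}(Y)=\mathcal{S}(j)^\perp$.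
   Context: There are $N$ players, indexed by $[N]=\{1,\ldots,N\}$; player $\ell$ has action $x_\ell\in\mathbb{R}^{n_\ell}$, $n=\sum_{\ell=1}^N n_\ell$, and $x=(x_1,\ldots,x_N)\in\mathbb{R}^n$ is the joint action. A quadratic game has costs $f_\ell(x)=\tfrac12 x_\ell^\top P_\ell x_\ell + x_\ell^\top\big(\sum_{m\neq \ell}P_{\ell m}x_m + r_\ell\big)$ with $P_\ell\in\mathbb{R}^{n_\ell\times n_\ell}$ symmetric, $P_{\ell m}\in\mathbb{R}^{n_\ell\times n_m}$, $r_\ell\in\mathbb{R}^{n_\ell}$. Each player $\ell$ has step size $\gamma_\ell>0$ and updates $x_\ell^{k+1}=x_\ell^k-\gamma_\ell\big(D_\ell f_\ell(x^k)+d_\ell^k\big)$, where $D_\ell f_\ell=\partial f_\ell/\partial x_\ell$ and $d_\ell^k\in\mathbb{R}^{n_\ell}$ is an arbitrary additive disturbance. Let $W\in\mathbb{R}^{n\times n}$ be the block matrix with blocks $W_{\ell\ell}=I_{n_\ell}-\gamma_\ell P_\ell$ and $W_{\ell m}=-\gamma_\ell P_{\ell m}$ ($\ell\neq m$), let $\Gamma=\mathrm{blkdiag}(\gamma_1 I_{n_1},\ldots,\gamma_N I_{n_N})$ and $\bar r=(r_1,\ldots,r_N)\in\mathbb{R}^n$. Let $\mathcal{D}_i=\{d=(d_1,\ldots,d_N)\in\mathbb{R}^n : d_m=0\ \forall m\neq i\}$ (disturbance only in player $i$'s gradient). The uncorrupted and corrupted dynamics are $x^{k+1}=Wx^k-\Gamma\bar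 r$ and $y^{k+1}=Wy^k-\Gamma\bar r-\Gamma d^k$. Player $j\neq i$ is said to be disturbance decoupled from player $i$ if for every initial joint action $x^0$, taking $y^0=x^0$, one has $y_j^k=x_j^k$ for all $k\ge 0$ and every disturbance sequence $(d^k)_{k\ge0}$ with $d^k\in\mathcal{D}_i$ for all $k$. *)

theory Defs
  imports "HOL-Analysis.Analysis"
begin

(* Coordinates of R^n are the finite type 'n; players are the finite type 'p;
   pl c is the player owning coordinate c.  The joint matrix P has blocks
   P_l (coordinates of player l x player l) and P_lm (player l x player m). *)

definition n_of :: "('n::finite \<Rightarrow> 'p) \<Rightarrow> 'p \<Rightarrow> nat" where
  "n_of pl l = card {c. pl c = l}"

definition Wmat :: "('n::finite \<Rightarrow> 'p) \<Rightarrow> ('p \<Rightarrow> real) \<Rightarrow> real^'n^'n \<Rightarrow> real^'n^'n" where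
  "Wmat pl \<gamma> P = (\<chi> a b. (if a = b then 1 else 0) - \<gamma> (pl a) * P$a$b)"

definition Gam :: "('n::finite \<Rightarrow> 'p) \<Rightarrow> ('p \<Rightarrow> real) \<Rightarrow> real^'n^'n" where
  "Gam pl \<gamma> = (\<chi> a b. if a = b then \<gamma> (pl a) else 0)"

(* uncorrupted dynamics x^{k+1} = W x^k - Gamma r *)
fun xtraj :: "real^'n^'n \<Rightarrow> real^'n^'n \<Rightarrow> real^'n \<Rightarrow> real^'n \<Rightarrow> nat \<Rightarrow> real^'n::finite" where
  "xtraj W G r x0 0 = x0"
| "xtraj W G r x0 (Suc k) = W *v xtraj W G r x0 k - G *v r"

(* corrupted dynamics y^{k+1} = W y^k - Gamma r - Gamma d^k *)
fun ytraj :: "real^'n^'n \<Rightarrow> real^'n^'n \<Rightarrow> real^'n \<Rightarrow> real^'n \<Rightarrow> (nat \<Rightarrow> real^'n) \<Rightarrow> nat \<Rightarrow> real^'n::finite" where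
  "ytraj W G r y0 d 0 = y0"
| "ytraj W G r y0 d (Suc k) = W *v ytraj W G r y0 d k - G *v r - G *v d k"

(* S(l): vectors supported on player l's coordinates (also the disturbance set D_l) *)
definition Ssub :: "('n::finite \<Rightarrow> 'p) \<Rightarrow> 'p \<Rightarrow> (real^'n) set" where
  "Ssub pl l = {x. \<forall>c. pl c \<noteq> l \<longrightarrow> x$c = 0}"

definition orth :: "(real^'n::finite) set \<Rightarrow> (real^'n) set" where
  "orth M = {x. \<forall>y\<in>M. x \<bullet> y = 0}"

fun matpow :: "real^'n^'n \<Rightarrow> nat \<Rightarrow> real^'n^'n::finite" where
  "matpow W 0 = mat 1"
| "matpow W (Suc k) = W ** matpow W k"

definition dist_decoupled ::
  "('n::finite \<Rightarrow> 'p) \<Rightarrow> ('p \<Rightarrow> real) \<Rightarrow> real^'n^'n \<Rightarrow> real^'n \<Rightarrow> 'p \<Rightarrow> 'p \<Rightarrow> bool" where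
  "dist_decoupled pl \<gamma> P r i j \<longleftrightarrow>
     (\<forall>x0 d. (\<forall>k. d k \<in> Ssub pl i) \<longrightarrow>
        (\<forall>k c. pl c = j \<longrightarrow>
           ytraj (Wmat pl \<gamma> P) (Gam pl \<gamma>) r x0 d k $ c = xtraj (Wmat pl \<gamma> P) (Gam pl \<gamma>) r x0 k $ c))"

end

theory Submission imports Defs begin

(* The error e^k = y^k - x^k obeys e^(k+1) = W e^k - Gamma d^k with e^0 = 0.
   Since Gamma is an invertible diagonal matrix preserving S(i), a single impulse
   disturbance produces the error W^k v for any v in S(i), which gives (i) => (ii).
   Conversely every error lies in the Krylov subspace spanned by the W^k S(i), k < n;
   it is W-invariant because the increasing chain of Krylov subspaces becomes stationary
   within n steps, so (ii) confines all errors to S(j)^perp.  Finally (iii) is (ii)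
   rewritten with im(W^k E) = W^k im(E). *)

definition krylov :: "real^'n^'n \<Rightarrow> (real^'n) set \<Rightarrow> nat \<Rightarrow> (real^'n::finite) set" where
  "krylov W S m = span {matpow W k *v v | k v. k < m \<and> v \<in> S}"

lemma krylov_mono: "m \<le> m' \<Longrightarrow> krylov W S m \<subseteq> krylov W S m'"
  unfolding krylov_def by (rule span_mono) (use order_less_le_trans in blast)

lemma matpow_mult_in_krylov: "k < m \<Longrightarrow> v \<in> S \<Longrightarrow> matpow W k *v v \<in> krylov W S m"
  unfolding krylov_def by (rule span_base) auto

lemma krylov_subset:
  assumes "subspace U" and "\<And>k v. k < m \<Longrightarrow> v \<in> S \<Longrightarrow> matpow W k *v v \<in> U"
  shows "krylov W S m \<subseteq> U"
  unfolding krylov_def using assms by (intro span_minimal) auto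

lemma matpow_Suc_mult [simp]: "matpow W (Suc k) *v v = W *v (matpow W k *v v)"
  by (simp add: matrix_vector_mul_assoc)

declare matpow.simps(2) [simp del]

lemma image_krylov_subset: "(*v) W ` krylov W S m \<subseteq> krylov W S (Suc m)"
proof -
  have "(*v) W ` krylov W S m = span ((*v) W ` {matpow W k *v v | k v. k < m \<and> v \<in> S})"
    unfolding krylov_def by (simp add: span_linear_image matrix_vector_mul_linear)
  also have "\<dots> \<subseteq> krylov W S (Suc m)"
  proof (rule span_minimal, clarsimp)
    fix k v assume "k < m" "v \<in> S"
    then show "W *v (matpow W k *v v) \<in> krylov W S (Suc m)"
      using matpow_mult_in_krylov[of "Suc k" "Suc m" v S W] by simp
  qed (simp add: krylov_def)
  finally show ?thesis .
qed

lemma matpow_mult_in_invariant: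
  assumes "v \<in> U" and "(*v) W ` U \<subseteq> U"
  shows "matpow W k *v v \<in> U"
  using assms by (induction k) auto

lemma krylov_stationary_exists:
  fixes S :: "(real^'n::finite) set"
  shows "\<exists>m\<le>CARD('n). krylov W S m = krylov W S (Suc m)"
proof (rule ccontr)
  assume "\<not> ?thesis"
  then have strict: "krylov W S m \<subset> krylov W S (Suc m)" if "m \<le> CARD('n)" for m
    using that krylov_mono[of m "Suc m" W S] by auto
  have "m \<le> dim (krylov W S m)" if "m \<le> Suc CARD('n)" for m
    using that
  proof (induction m)
    case (Suc m)
    have "dim (krylov W S m) < dim (krylov W S (Suc m))"
      using strict[of m] Suc.prems by (intro dim_psubset) (simp add: krylov_def span_span)
    with Suc show ?case by simp
  qed simp
  then show False
    using dim_subset_UNIV_cart[of "krylov W S (Suc CARD('n))"] by (metis order_refl not_less_eq_eq)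
qed

lemma krylov_invariant:
  fixes S :: "(real^'n::finite) set"
  shows "(*v) W ` krylov W S CARD('n) \<subseteq> krylov W S CARD('n)"
proof -
  obtain m where m: "m \<le> CARD('n)" "krylov W S m = krylov W S (Suc m)"
    using krylov_stationary_exists by blast
  have inv: "(*v) W ` krylov W S m \<subseteq> krylov W S m"
    using image_krylov_subset m(2) by metis
  have "krylov W S CARD('n) \<subseteq> krylov W S m"
  proof (rule krylov_subset)
    show "subspace (krylov W S m)"
      by (simp add: krylov_def)
    fix k v assume "v \<in> S"
    then have "v \<in> krylov W S m"
      using matpow_mult_in_krylov[of 0 "Suc m" v S W] m(2) by simp
    then show "matpow W k *v v \<in> krylov W S m"
      using inv by (rule matpow_mult_in_invariant)
  qed
  with krylov_mono[OF m(1)] inv show ?thesis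
    by (metis subset_antisym)
qed

lemma ytraj_minus_xtraj_Suc:
  "ytraj W G r x0 d (Suc k) - xtraj W G r x0 (Suc k)
     = W *v (ytraj W G r x0 d k - xtraj W G r x0 k) - G *v d k"
  by (simp add: matrix_vector_mult_diff_distrib)

lemma ytraj_minus_xtraj_in_invariant_subspace:
  assumes "subspace U" "(*v) W ` U \<subseteq> U" "\<And>t. G *v d t \<in> U"
  shows "ytraj W G r x0 d k - xtraj W G r x0 k \<in> U"
proof (induction k)
  case 0
  then show ?case
    using assms(1) by (simp add: subspace_0)
next
  case (Suc k)
  then show ?case
    unfolding ytraj_minus_xtraj_Suc using assms by (intro subspace_diff) auto
qed

lemma ytraj_minus_xtraj_impulse:
  assumes "G *v d 0 = - v" and "\<And>t. d (Suc t) = 0"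
  shows "ytraj W G r x0 d (Suc k) - xtraj W G r x0 (Suc k) = matpow W k *v v"
proof (induction k)
  case 0
  then show ?case
    using assms(1) ytraj_minus_xtraj_Suc[of W G r x0 d 0] by simp
next
  case (Suc k)
  then show ?case
    using assms(2) ytraj_minus_xtraj_Suc[of W G r x0 d "Suc k"] by simp
qed

lemma orth_Ssub: "orth (Ssub pl j) = {x::real^'n::finite. \<forall>c. pl c = j \<longrightarrow> x$c = 0}"
proof (intro set_eqI iffI CollectI allI impI)
  fix x c assume x: "x \<in> orth (Ssub pl j)" and "pl c = j"
  then have "axis c 1 \<in> Ssub pl j"
    by (auto simp: Ssub_def axis_def)
  with x show "x$c = 0"
    by (auto simp: orth_def inner_axis)
next
  fix x :: "real^'n" assume "x \<in> {x. \<forall>c. pl c = j \<longrightarrow> x$c = 0}"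
  then show "x \<in> orth (Ssub pl j)"
    unfolding orth_def Ssub_def inner_vec_def by (auto intro!: sum.neutral) (metis)
qed

lemma subspace_orth: "subspace (orth M)"
  unfolding orth_def subspace_def by (auto simp: inner_add_left)

lemma Gam_mult_nth: "(Gam pl \<gamma> *v x)$a = \<gamma> (pl a) * x$a"
proof -
  have "(Gam pl \<gamma> *v x)$a = (\<Sum>b\<in>UNIV. if b = a then \<gamma> (pl a) * x$a else 0)"
    unfolding Gam_def matrix_vector_mult_def vec_lambda_beta by (intro sum.cong) auto
  then show ?thesis
    by simp
qed

lemma Gam_mult_in_Ssub: "x \<in> Ssub pl l \<Longrightarrow> Gam pl \<gamma> *v x \<in> Ssub pl l"
  by (simp add: Ssub_def Gam_mult_nth)

lemma Gam_mult_inverse: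
  assumes "\<forall>l. \<gamma> l \<noteq> 0"
  shows "Gam pl \<gamma> *v (\<chi> c. x$c / \<gamma> (pl c)) = x"
  using assms by (simp add: vec_eq_iff Gam_mult_nth)

lemma impulse_response_orth_if_decoupled:
  fixes pl :: "'n::finite \<Rightarrow> 'p"
  assumes "\<forall>l. \<gamma> l \<noteq> 0" and "dist_decoupled pl \<gamma> P r i j" and v: "v \<in> Ssub pl i"
  shows "matpow (Wmat pl \<gamma> P) k *v v \<in> orth (Ssub pl j)"
proof -
  define d :: "nat \<Rightarrow> real^'n" where "d t = (if t = 0 then (\<chi> c. (- v)$c / \<gamma> (pl c)) else 0)" for t
  have "d t \<in> Ssub pl i" for t
    using v by (auto simp: d_def Ssub_def)
  then have "ytraj (Wmat pl \<gamma> P) (Gam pl \<gamma>) r 0 d (Suc k) $ c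
      = xtraj (Wmat pl \<gamma> P) (Gam pl \<gamma>) r 0 (Suc k) $ c" if "pl c = j" for c
    using assms(2)[unfolded dist_decoupled_def, rule_format, of d] that by blast
  moreover have "ytraj (Wmat pl \<gamma> P) (Gam pl \<gamma>) r 0 d (Suc k) - xtraj (Wmat pl \<gamma> P) (Gam pl \<gamma>) r 0 (Suc k)
      = matpow (Wmat pl \<gamma> P) k *v v"
    using Gam_mult_inverse[OF assms(1), of pl "- v"] by (intro ytraj_minus_xtraj_impulse) (simp_all add: d_def)
  ultimately have "(matpow (Wmat pl \<gamma> P) k *v v)$c = 0" if "pl c = j" for c
    using that by (metis vector_minus_component diff_self)
  then show ?thesis
    by (simp add: orth_Ssub)
qed

lemma decoupled_if_krylov_orth:
  fixes pl :: "'n::finite \<Rightarrow> 'p"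
  assumes "krylov (Wmat pl \<gamma> P) (Ssub pl i) CARD('n) \<subseteq> orth (Ssub pl j)"
  shows "dist_decoupled pl \<gamma> P r i j"
  unfolding dist_decoupled_def
proof (intro allI impI)
  fix x0 and d :: "nat \<Rightarrow> real^'n" and k c
  assume d: "\<forall>k. d k \<in> Ssub pl i" and c: "pl c = j"
  let ?K = "krylov (Wmat pl \<gamma> P) (Ssub pl i) CARD('n)"
  have "subspace ?K"
    by (simp add: krylov_def)
  moreover have "(*v) (Wmat pl \<gamma> P) ` ?K \<subseteq> ?K"
    by (rule krylov_invariant)
  moreover have "Gam pl \<gamma> *v d t \<in> ?K" for t
  proof -
    have "Gam pl \<gamma> *v d t \<in> Ssub pl i"
      using d by (simp add: Gam_mult_in_Ssub)
    then show ?thesis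
      using matpow_mult_in_krylov[of 0 "CARD('n)" _ "Ssub pl i" "Wmat pl \<gamma> P"] by simp
  qed
  ultimately have "ytraj (Wmat pl \<gamma> P) (Gam pl \<gamma>) r x0 d k - xtraj (Wmat pl \<gamma> P) (Gam pl \<gamma>) r x0 k \<in> ?K"
    by (rule ytraj_minus_xtraj_in_invariant_subspace)
  then have "ytraj (Wmat pl \<gamma> P) (Gam pl \<gamma>) r x0 d k - xtraj (Wmat pl \<gamma> P) (Gam pl \<gamma>) r x0 k
      \<in> orth (Ssub pl j)"
    using assms by (rule subsetD[rotated])
  with c show "ytraj (Wmat pl \<gamma> P) (Gam pl \<gamma>) r x0 d k $ c = xtraj (Wmat pl \<gamma> P) (Gam pl \<gamma>) r x0 k $ c"
    by (simp add: orth_Ssub)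
qed

lemma decoupled_iff_impulse_response_orth:
  fixes pl :: "'n::finite \<Rightarrow> 'p"
  assumes "\<forall>l. \<gamma> l \<noteq> 0"
  shows "dist_decoupled pl \<gamma> P r i j \<longleftrightarrow>
    (\<forall>v\<in>Ssub pl i. \<forall>k<CARD('n). matpow (Wmat pl \<gamma> P) k *v v \<in> orth (Ssub pl j))"
proof
  assume "dist_decoupled pl \<gamma> P r i j"
  then show "\<forall>v\<in>Ssub pl i. \<forall>k<CARD('n). matpow (Wmat pl \<gamma> P) k *v v \<in> orth (Ssub pl j)"
    using impulse_response_orth_if_decoupled[OF assms] by blast
next
  assume "\<forall>v\<in>Ssub pl i. \<forall>k<CARD('n). matpow (Wmat pl \<gamma> P) k *v v \<in> orth (Ssub pl j)"
  then have "krylov (Wmat pl \<gamma> P) (Ssub pl i) CARD('n) \<subseteq> orth (Ssub pl j)"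
    by (intro krylov_subset subspace_orth) auto
  then show "dist_decoupled pl \<gamma> P r i j"
    by (rule decoupled_if_krylov_orth)
qed

lemma range_matrix_mult: "range ((*v) (A ** B)) = (*v) A ` range ((*v) B)"
  by (simp add: image_image matrix_vector_mul_assoc)

lemma exists_matrix_range_eq_coordinate_subspace:
  fixes C :: "'n::finite set"
  assumes "CARD('c::finite) = card C"
  shows "\<exists>E::real^'c^'n. range ((*v) E) = {x. \<forall>a. a \<notin> C \<longrightarrow> x$a = 0}"
proof -
  obtain f :: "'c \<Rightarrow> 'n" where f: "bij_betw f UNIV C"
    using finite_same_card_bij[of "UNIV::'c set" C] assms by auto
  define E :: "real^'c^'n" where "E = (\<chi> a b. if f b = a then 1 else 0)"
  have fiber: "{b. f b = a} = (if a \<in> C then {inv_into UNIV f a} else {})" for a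
    using f by (auto simp: bij_betw_def bij_betw_inv_into_right inj_eq)
  have E_mult: "(E *v z)$a = (if a \<in> C then z $ inv_into UNIV f a else 0)" for z a
  proof -
    have "(E *v z)$a = (\<Sum>b\<in>UNIV. if f b = a then z$b else 0)"
      unfolding E_def matrix_vector_mult_def by (auto intro: sum.cong)
    also have "\<dots> = (\<Sum>b | f b = a. z$b)"
      by (simp add: sum.If_cases)
    finally show ?thesis
      by (simp add: fiber)
  qed
  have "range ((*v) E) = {x. \<forall>a. a \<notin> C \<longrightarrow> x$a = 0}"
  proof (intro set_eqI iffI)
    fix y :: "real^'n" assume y: "y \<in> {x. \<forall>a. a \<notin> C \<longrightarrow> x$a = 0}"
    have "E *v (\<chi> b. y$(f b)) = y"
      using y f by (auto simp: vec_eq_iff E_mult bij_betw_inv_into_right)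
    then show "y \<in> range ((*v) E)"
      by (metis rangeI)
  qed (auto simp: E_mult)
  then show ?thesis
    by blast
qed

lemma all_range_mult_subset_iff:
  fixes M :: "nat \<Rightarrow> real^'n^'n::finite"
  assumes "range ((*v) (E0::real^'c^'n)) = A" and "range ((*v) (Y0::real^'d^'n)) = B"
  shows "(\<forall>(E::real^'c^'n) (Y::real^'d^'n). range ((*v) E) = A \<longrightarrow> range ((*v) Y) = B \<longrightarrow>
            (\<forall>k<m. range ((*v) (M k ** E)) \<subseteq> range ((*v) Y)))
      \<longleftrightarrow> (\<forall>v\<in>A. \<forall>k<m. M k *v v \<in> B)"
proof
  assume H: "\<forall>(E::real^'c^'n) (Y::real^'d^'n). range ((*v) E) = A \<longrightarrow> range ((*v) Y) = B \<longrightarrow>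
            (\<forall>k<m. range ((*v) (M k ** E)) \<subseteq> range ((*v) Y))"
  show "\<forall>v\<in>A. \<forall>k<m. M k *v v \<in> B"
  proof (intro ballI allI impI)
    fix v k assume "v \<in> A" "k < m"
    then have "M k *v v \<in> range ((*v) (M k ** E0))"
      using assms(1) by (auto simp: range_matrix_mult)
    also have "\<dots> \<subseteq> range ((*v) Y0)"
      using H assms \<open>k < m\<close> by blast
    finally show "M k *v v \<in> B"
      using assms(2) by simp
  qed
qed (auto simp: range_matrix_mult)

theorem proposition1:
  fixes pl :: "'n::finite \<Rightarrow> 'p::finite"
    and \<gamma> :: "'p \<Rightarrow> real"
    and P :: "real^'n^'n"
    and r :: "real^'n"
    and i j :: 'p
  assumes players_nonempty: "\<forall>l. \<exists>c. pl c = l"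
    and step_pos: "\<forall>l. \<gamma> l > 0"
    and P_sym: "\<forall>a b. pl a = pl b \<longrightarrow> P$a$b = P$b$a"
    and ij: "j \<noteq> i"
    and cardE: "CARD('ci::finite) = n_of pl i"
    and cardY: "CARD('cj::finite) = CARD('n) - n_of pl j"
  shows "(dist_decoupled pl \<gamma> P r i j
           \<longleftrightarrow> (\<forall>v\<in>Ssub pl i. \<forall>k<CARD('n). matpow (Wmat pl \<gamma> P) k *v v \<in> orth (Ssub pl j)))
       \<and> (dist_decoupled pl \<gamma> P r i j
           \<longleftrightarrow> (\<forall>(E::real^'ci^'n) (Y::real^'cj^'n).
                 range ((*v) E) = Ssub pl i \<longrightarrow> range ((*v) Y) = orth (Ssub pl j) \<longrightarrow>
                 (\<forall>k<CARD('n). range ((*v) (matpow (Wmat pl \<gamma> P) k ** E)) \<subseteq> range ((*v) Y))))"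
proof -
  have \<gamma>: "\<forall>l. \<gamma> l \<noteq> 0"
    using step_pos by (metis less_irrefl)
  obtain E :: "real^'ci^'n" where E: "range ((*v) E) = Ssub pl i"
    using exists_matrix_range_eq_coordinate_subspace[of "{c. pl c = i}"] cardE
    by (auto simp: n_of_def Ssub_def)
  obtain Y :: "real^'cj^'n" where Y: "range ((*v) Y) = orth (Ssub pl j)"
    using exists_matrix_range_eq_coordinate_subspace[of "- {c. pl c = j}"] cardY
    by (auto simp: n_of_def orth_Ssub Compl_eq_Diff_UNIV card_Diff_subset)
  show ?thesis
    using decoupled_iff_impulse_response_orth[OF \<gamma>] all_range_mult_subset_iff[OF E Y] by simp
qed

end
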